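(* Let $s\in(0,1)$, $R\ge2$, and let $u$ be a minimizer of $\mathcal E^p_s$ in $X^{s,p}(B_{R+2})$. Then there exists $\bar C\in(0,+\infty)$ depending only on $n,p,m,\Lambda$ such that $$\mathcal E^p_s(u,B_R)\le\frac{\bar C}{s}\begin{cases}\dfrac{R^{n-sp}}{1-sp}&\text{if } s\in(0,\frac1p),\\[2mm] R^{n-1}\log R&\text{if } s=\frac1p,\\[1mm] \dfrac{R^{n-1}}{sp-1}&\text{if } s\in(\frac1p,1).\end{cases}$$
   Context: Standing setting: $n\in\mathbb N$, $p\in(1,+\infty)$, $B_r$ the open ball of radius $r$ centered at $0$. $W:[-1,1]\to[0,+\infty)$ is lower semicontinuous and satisfies: (W1) there are $\lambda\in(0,1]$, $\Lambda\in[1,+\infty)$, $\theta\in(-1,1)$, $m\in[p,+\infty)$ with $\lambda\chi_{(-\infty,\theta]}(x)|1+x|^m\le W(x)\le\Lambda|1+x|^m$ for all $x\in[-1,1]$; (W2) there are $q\in(0,1)$, $c_1\in(0,+\infty)$ such that for all $-1\le r\le t\le -1+q$, $W(t)-W(r)\ge c_1(t-r)|1+r|^{m-1}+c_1(t-r)^k$, where $k=m$ if $m\in\mathbb N$ and $k=\lfloor m\rfloor+1$ otherwise. For an open set $\Omega$ and measurable $u:\mathbb R^n\to\mathbb R$, $\mathcal K^p_s(u,\Omega):=\frac12\int_\Omega\int_\Omega\frac{|u(x)-u(y)|^p}{|x-y|^{n+sp}}dx\,dy+\int_\Omega\int_{\mathbb R^n\setminus\Omega}\frac{|u(x)-u(y)|^p}{|x-y|^{n+sp}}dx\,dy$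 and $\mathcal E^p_s(u,\Omega):=(1-s)\mathcal K^p_s(u,\Omega)+\int_\Omega W(u(x))dx$. $X^{s,p}(\Omega)$ is the set of measurable $u:\mathbb R^n\to\mathbb R$ with $\mathcal K^p_s(u,\Omega)<\infty$ and $\|u\|_{L^\infty(\mathbb R^n)}\le1$. "$u$ is a minimizer of $\mathcal E^p_s$ in $X^{s,p}(\Omega)$" means $u\in X^{s,p}(\Omega)$ and $\mathcal E^p_s(u,\Omega)\le\mathcal E^p_s(v,\Omega)$ for all $v\in X^{s,p}(\Omega)$ with $v=u$ a.e. in $\mathbb R^n\setminus\Omega$. *)

theory Defs
  imports "HOL-Analysis.Analysis"
begin

definition lsc_on_interval :: "(real \<Rightarrow> real) \<Rightarrow> bool" where
  "lsc_on_interval W \<longleftrightarrow> (\<forall>x\<in>{-1..1}. \<forall>t. t < W x \<longrightarrow>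
      (\<exists>e>0. \<forall>y\<in>{-1..1}. \<bar>y - x\<bar> < e \<longrightarrow> t < W y))"

definition W1 :: "(real \<Rightarrow> real) \<Rightarrow> real \<Rightarrow> real \<Rightarrow> real \<Rightarrow> real \<Rightarrow> bool" where
  "W1 W lam Lam theta m \<longleftrightarrow>
     (\<forall>x\<in>{-1..1}. lam * indicator {..theta} x * \<bar>1 + x\<bar> powr m \<le> W x
                  \<and> W x \<le> Lam * \<bar>1 + x\<bar> powr m)"

definition kexp :: "real \<Rightarrow> real" where
  "kexp m = (if m \<in> \<nat> then m else of_int \<lfloor>m\<rfloor> + 1)"

definition W2 :: "(real \<Rightarrow> real) \<Rightarrow> real \<Rightarrow> real \<Rightarrow> real \<Rightarrow> bool" where
  "W2 W q c1 m \<longleftrightarrow>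
     (\<forall>r t. -1 \<le> r \<and> r \<le> t \<and> t \<le> -1 + q \<longrightarrow>
        W t - W r \<ge> c1 * (t - r) * \<bar>1 + r\<bar> powr (m - 1) + c1 * (t - r) powr (kexp m))"

definition Kps :: "real \<Rightarrow> real \<Rightarrow> ('a::euclidean_space \<Rightarrow> real) \<Rightarrow> 'a set \<Rightarrow> ennreal" where
  "Kps p s u \<Omega> =
     (1/2) * (\<integral>\<^sup>+ x. \<integral>\<^sup>+ y. ennreal (indicator \<Omega> x * indicator \<Omega> y *
          (\<bar>u x - u y\<bar> powr p / norm (x - y) powr (real DIM('a) + s * p))) \<partial>lebesgue \<partial>lebesgue)
   + (\<integral>\<^sup>+ x. \<integral>\<^sup>+ y. ennreal (indicator \<Omega> x * indicator (- \<Omega>) y *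
          (\<bar>u x - u y\<bar> powr p / norm (x - y) powr (real DIM('a) + s * p))) \<partial>lebesgue \<partial>lebesgue)"

definition Eps :: "(real \<Rightarrow> real) \<Rightarrow> real \<Rightarrow> real \<Rightarrow> ('a::euclidean_space \<Rightarrow> real) \<Rightarrow> 'a set \<Rightarrow> ennreal" where
  "Eps W p s u \<Omega> = ennreal (1 - s) * Kps p s u \<Omega>
     + (\<integral>\<^sup>+ x. ennreal (indicator \<Omega> x * W (u x)) \<partial>lebesgue)"

definition Xsp :: "real \<Rightarrow> real \<Rightarrow> 'a::euclidean_space set \<Rightarrow> ('a \<Rightarrow> real) set" where
  "Xsp s p \<Omega> = {u. u \<in> borel_measurable lebesgue \<and> Kps p s u \<Omega> < \<infinity>
                     \<and> (AE x in lebesgue. \<bar>u x\<bar> \<le> 1)}"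

definition minimizer :: "(real \<Rightarrow> real) \<Rightarrow> real \<Rightarrow> real \<Rightarrow> ('a::euclidean_space \<Rightarrow> real) \<Rightarrow> 'a set \<Rightarrow> bool" where
  "minimizer W p s u \<Omega> \<longleftrightarrow> u \<in> Xsp s p \<Omega> \<and>
     (\<forall>v \<in> Xsp s p \<Omega>. (AE x in lebesgue. x \<notin> \<Omega> \<longrightarrow> v x = u x) \<longrightarrow> Eps W p s u \<Omega> \<le> Eps W p s v \<Omega>)"

end

theory Submission
  imports Defs
begin

text \<open>
  Let $\psi = -1$ in $B_{R+1}$, $\psi = 1$ outside $B_{R+2}$, with $\psi$ affine in $|x|$ in between, and compare
  $u$ with $v = \min(u, \psi)$. Pointwise $|v(x)-v(y)|^p \le |u(x)-u(y)|^p + |\psi(x)-\psi(y)|^p$,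
  and if $x, y \in B_{R+1}$ then the left side vanishes, so that $|u(x)-u(y)|^p$ may be added to it;
  the same holds for the potential because $W(-1) = 0$. Integrating, and cancelling the finite
  energy of $u$ by minimality, bounds the energy inside $B_{R+1}$ by
  the energy of $\psi$ in $B_{R+2}$. The interactions of $B_R$ with the complement of $B_{R+1}$
  are bounded using only $|u| \le 1$: both this term and the energy of $\psi$
  reduce to $\int_{B_R} (R+1-|x|)^{-sp}\,dx$ and to the volume of the shell $B_{R+2} \setminus B_R$.
\<close>

subsection \<open>Radial integrals\<close>

text \<open>Why a minimum: \<open>min\<close> is nonexpansive for the maximum of two distances, so
  the energy of \<open>u\<close> enters the estimate for v with coefficient exactly 1. An estimate
  by convexity would put a constant larger than 1 in front of it, and minimality could no longer
  cancel it.

  Why three radii: the kernel is singular across the boundary of a ball, and the interaction of B_R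
  with its whole complement, estimated from boundedness alone, diverges as soon as s p \<ge> 1. The
  gap between R and R+1 removes this singularity. The interactions thereby left out, of B_R with the
  shell up to R+1, lie in the square of B_{R+1}, where minimality controls them. The gap from R+1 to
  R+2 leaves room for a Lipschitz transition.

  Origin of the constants: the tail of |z|^(-n-sp) integrates to a multiple of 1/(s p), whence the
  factor 1/s. Near the diagonal a Lipschitz function produces 1/(p (1-s)), which the weight 1-s of
  the energy absorbs, so nothing degenerates as s tends to 1 except through the growth rate.\<close>

definition sphere_area :: "'a::euclidean_space itself \<Rightarrow> real" where
  "sphere_area _ = real DIM('a) * unit_ball_vol (real DIM('a))"

lemma sphere_area_pos: "sphere_area TYPE('a::euclidean_space) > 0"
  by (simp add: sphere_area_def)

text \<open>Polar coordinates for radial functions. The half-lines form an intersection-stable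
  generator, so comparing the two measures there is enough: one side is the volume of a ball, the
  other the integral of its derivative in the radius.\<close>

lemma distr_norm_lborel:
  "distr lborel borel (norm :: 'a::euclidean_space \<Rightarrow> real) =
     density lborel (\<lambda>r. ennreal (sphere_area TYPE('a) * r ^ (DIM('a) - 1)) * indicator {0..} r)"
    (is "?M = ?N")
proof (rule measure_eqI_generator_eq[where E = "range (\<lambda>a::real. {..a})" and \<Omega> = UNIV
      and A = "\<lambda>i::nat. {..real i}"])
  show "Int_stable (range (\<lambda>a::real. {..a}))"
    by (auto simp: Int_stable_def)
  have M: "emeasure ?M {..a} = ennreal (unit_ball_vol DIM('a) * a ^ DIM('a)) * indicator {0..} a" for a
  proof -
    have "emeasure ?M {..a} = emeasure lborel (cball (0::'a) a)"
      by (subst emeasure_distr) (auto intro!: arg_cong[where f="emeasure lborel"] simp: vimage_def)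
    then show ?thesis
      by (cases "a \<ge> 0") (auto simp: emeasure_cball)
  qed
  have N: "emeasure ?N {..a} = ennreal (unit_ball_vol DIM('a) * a ^ DIM('a)) * indicator {0..} a" for a
  proof -
    have "emeasure ?N {..a} =
        (\<integral>\<^sup>+r. ennreal (sphere_area TYPE('a) * r ^ (DIM('a) - 1)) * indicator {0..a} r \<partial>lborel)"
      by (subst emeasure_density) (auto intro!: nn_integral_cong split: split_indicator)
    also have "\<dots> = ennreal (unit_ball_vol DIM('a) * a ^ DIM('a)) * indicator {0..} a"
    proof (cases "a \<ge> 0")
      case True
      have "(\<integral>\<^sup>+r. ennreal (sphere_area TYPE('a) * r ^ (DIM('a) - 1)) * indicator {0..a} r \<partial>lborel)
          = unit_ball_vol DIM('a) * a ^ DIM('a) - unit_ball_vol DIM('a) * 0 ^ DIM('a)"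
        using True sphere_area_pos[where 'a='a]
        by (intro nn_integral_FTC_Icc)
           (auto simp: sphere_area_def intro!: derivative_eq_intros mult_nonneg_nonneg)
      then show ?thesis using True by simp
    qed auto
    finally show ?thesis .
  qed
  show "emeasure ?M X = emeasure ?N X" if "X \<in> range (\<lambda>a::real. {..a})" for X
    using that M N by auto
  show "(\<Union>i. {..real i}) = UNIV"
    by (auto intro: real_arch_simple)
  show "emeasure ?M {..real i} \<noteq> \<infinity>" for i
    unfolding M by (auto simp: indicator_def)
qed (auto simp: borel_eq_atMost)

lemma nn_integral_norm:
  fixes f :: "real \<Rightarrow> ennreal"
  assumes [measurable]: "f \<in> borel_measurable borel"
  shows "(\<integral>\<^sup>+(x::'a::euclidean_space). f (norm x) \<partial>lborel) =
    (\<integral>\<^sup>+r. ennreal (sphere_area TYPE('a) * r ^ (DIM('a) - 1)) * indicator {0..} r * f r \<partial>lborel)"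
proof -
  have "(\<integral>\<^sup>+(x::'a). f (norm x) \<partial>lborel) = (\<integral>\<^sup>+r. f r \<partial>distr lborel borel (norm :: 'a \<Rightarrow> real))"
    by (subst nn_integral_distr) auto
  then show ?thesis
    unfolding distr_norm_lborel by (subst (asm) nn_integral_density) auto
qed

lemma nn_integral_lborel_diff:
  fixes f :: "'a::euclidean_space \<Rightarrow> ennreal"
  assumes [measurable]: "f \<in> borel_measurable borel"
  shows "(\<integral>\<^sup>+y. f (x - y) \<partial>lborel) = (\<integral>\<^sup>+z. f z \<partial>lborel)"
proof -
  have "(\<integral>\<^sup>+z. f z \<partial>lborel) = (\<integral>\<^sup>+z. f z \<partial>density (distr lborel borel (\<lambda>y. x + (-1::real) *\<^sub>R y)) (\<lambda>_. 1))"
    by (subst lborel_affine[of "-1" x]) simp_all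
  then show ?thesis
    by (simp add: density_1 nn_integral_distr)
qed

text \<open>The polar Jacobian is a natural power, the kernels are real powers. The condition on
  \<open>n\<close> keeps the natural subtraction from truncating.\<close>

lemma powr_power_mult:
  fixes r e :: real
  assumes "r > 0" "n \<ge> 1"
  shows "r ^ (n - 1) * r powr e = r powr (real n - 1 + e)"
  using assms by (simp add: powr_add of_nat_diff flip: powr_realpow)

text \<open>The Jacobian cancels the dimension and leaves the exponent -1 - \<open>\<sigma>\<close>.
  It is applied with \<open>\<sigma>\<close> = s p and is the source of the factor 1/s.\<close>

lemma nn_integral_norm_powr_outside_ball:
  fixes \<sigma> d :: real
  assumes "\<sigma> > 0" "d > 0"
  shows "(\<integral>\<^sup>+(z::'a::euclidean_space). ennreal (indicator {d..} (norm z) * norm z powr (- (DIM('a) + \<sigma>))) \<partial>lborel)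
     = ennreal (sphere_area TYPE('a) * d powr (-\<sigma>) / \<sigma>)"
proof -
  let ?c = "sphere_area TYPE('a)"
  have "(\<integral>\<^sup>+(z::'a). ennreal (indicator {d..} (norm z) * norm z powr (- (DIM('a) + \<sigma>))) \<partial>lborel)
    = (\<integral>\<^sup>+r. ennreal (?c * r ^ (DIM('a) - 1)) * indicator {0..} r *
         ennreal (indicator {d..} r * r powr (- (DIM('a) + \<sigma>))) \<partial>lborel)"
    by (rule nn_integral_norm) measurable
  also have "\<dots> = (\<integral>\<^sup>+r. ennreal ?c * (ennreal (r powr (-1 - \<sigma>)) * indicator {d..} r) \<partial>lborel)"
  proof (rule nn_integral_cong)
    fix r :: real
    show "ennreal (?c * r ^ (DIM('a) - 1)) * indicator {0..} r *
         ennreal (indicator {d..} r * r powr (- (DIM('a) + \<sigma>)))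
       = ennreal ?c * (ennreal (r powr (-1 - \<sigma>)) * indicator {d..} r)"
    proof (cases "r \<ge> d")
      case True
      have "ennreal (?c * r ^ (DIM('a) - 1)) * ennreal (r powr (- (DIM('a) + \<sigma>)))
         = ennreal (?c * (r ^ (DIM('a) - 1) * r powr (- (DIM('a) + \<sigma>))))"
        using True assms sphere_area_pos[where 'a='a]
        by (subst ennreal_mult[symmetric]) (auto simp: mult.assoc)
      also have "r ^ (DIM('a) - 1) * r powr (- (DIM('a) + \<sigma>)) = r powr (-1 - \<sigma>)"
        using True assms by (subst powr_power_mult) (auto simp: Suc_leI)
      finally show ?thesis
        using True assms sphere_area_pos[where 'a='a] by (simp add: ennreal_mult)
    qed auto
  qed
  also have "\<dots> = ennreal ?c * (\<integral>\<^sup>+r. ennreal (r powr (-1 - \<sigma>)) * indicator {d..} r \<partial>lborel)"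
    by (rule nn_integral_cmult) measurable
  also have "(\<integral>\<^sup>+r. ennreal (r powr (-1 - \<sigma>)) * indicator {d..} r \<partial>lborel) = ennreal (d powr (-\<sigma>) / \<sigma>)"
  proof -
    have "((\<lambda>r. r powr (-1 - \<sigma>)) has_integral d powr (-\<sigma>) / \<sigma>) {d..}"
      using has_integral_powr_to_inf[of "-1 - \<sigma>" d] assms by simp
    from nn_integral_has_integral_lebesgue'[OF _ this] show ?thesis by simp
  qed
  finally show ?thesis
    using sphere_area_pos[where 'a='a] assms by (simp flip: ennreal_mult)
qed

lemma nn_integral_norm_powr_unit_ball:
  fixes a :: real
  assumes "a > 0"
  shows "(\<integral>\<^sup>+(z::'a::euclidean_space). ennreal (indicator {0<..1} (norm z) * norm z powr (a - DIM('a))) \<partial>lborel)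
     = ennreal (sphere_area TYPE('a) / a)"
proof -
  let ?c = "sphere_area TYPE('a)"
  have "(\<integral>\<^sup>+(z::'a). ennreal (indicator {0<..1} (norm z) * norm z powr (a - DIM('a))) \<partial>lborel)
    = (\<integral>\<^sup>+r. ennreal (?c * r ^ (DIM('a) - 1)) * indicator {0..} r *
         ennreal (indicator {0<..1} r * r powr (a - DIM('a))) \<partial>lborel)"
    by (rule nn_integral_norm) measurable
  \<comment> \<open>Closing the interval at 0 is harmless: \<open>0 powr e\<close> is 0 for every
    \<open>e\<close>.\<close>
  also have "\<dots> = (\<integral>\<^sup>+r. ennreal ?c * (ennreal (r powr (a - 1)) * indicator {0..1} r) \<partial>lborel)"
  proof (rule nn_integral_cong)
    fix r :: real
    show "ennreal (?c * r ^ (DIM('a) - 1)) * indicator {0..} r *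
         ennreal (indicator {0<..1} r * r powr (a - DIM('a)))
       = ennreal ?c * (ennreal (r powr (a - 1)) * indicator {0..1} r)"
    proof (cases "r > 0 \<and> r \<le> 1")
      case True
      have "ennreal (?c * r ^ (DIM('a) - 1)) * ennreal (r powr (a - DIM('a)))
         = ennreal (?c * (r ^ (DIM('a) - 1) * r powr (a - DIM('a))))"
        using True assms sphere_area_pos[where 'a='a]
        by (subst ennreal_mult[symmetric]) (auto simp: mult.assoc)
      also have "r ^ (DIM('a) - 1) * r powr (a - DIM('a)) = r powr (a - 1)"
        using True assms by (subst powr_power_mult) (auto simp: Suc_leI)
      finally show ?thesis
        using True assms sphere_area_pos[where 'a='a] by (simp add: ennreal_mult)
    qed (auto simp: indicator_def)
  qed
  also have "\<dots> = ennreal ?c * (\<integral>\<^sup>+r. ennreal (r powr (a - 1)) * indicator {0..1} r \<partial>lborel)"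
    by (rule nn_integral_cmult) measurable
  also have "(\<integral>\<^sup>+r. ennreal (r powr (a - 1)) * indicator {0..1} r \<partial>lborel) = ennreal (1 / a)"
  proof -
    have "((\<lambda>r. r powr (a - 1)) has_integral 1 / a) {0..1}"
      using has_integral_powr_from_0[of "a - 1" 1] assms by simp
    from nn_integral_has_integral_lebesgue'[OF _ this] show ?thesis by simp
  qed
  finally show ?thesis
    using sphere_area_pos[where 'a='a] assms by (simp flip: ennreal_mult)
qed

text \<open>Since R \<ge> 2, all radii in the shell are at most 2R. This gives a factor 2^(n-1), and
  the width 2 completes it to 2^n.\<close>

lemma emeasure_shell_le:
  fixes R :: real
  assumes "R \<ge> 2"
  shows "emeasure lborel (ball (0::'a::euclidean_space) (R + 2) - ball 0 R)
    \<le> ennreal (sphere_area TYPE('a) * 2 ^ DIM('a) * R ^ (DIM('a) - 1))"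
proof -
  let ?c = "sphere_area TYPE('a)"
  have "emeasure lborel (ball (0::'a) (R + 2) - ball 0 R)
     = (\<integral>\<^sup>+(z::'a). indicator {R..<R+2} (norm z) \<partial>lborel)"
    by (subst nn_integral_indicator[symmetric], simp, rule nn_integral_cong) (auto split: split_indicator)
  also have "\<dots> = (\<integral>\<^sup>+r. ennreal (?c * r ^ (DIM('a) - 1)) * indicator {0..} r * indicator {R..<R+2} r \<partial>lborel)"
    by (rule nn_integral_norm) measurable
  also have "\<dots> \<le> (\<integral>\<^sup>+r. ennreal (?c * (2 * R) ^ (DIM('a) - 1)) * indicator {R..R+2} r \<partial>lborel)"
  proof (intro nn_integral_mono)
    fix r :: real
    have "r ^ (DIM('a) - 1) \<le> (2 * R) ^ (DIM('a) - 1)" if "R \<le> r" "r < R + 2"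
      using that assms by (intro power_mono) auto
    then have "?c * r ^ (DIM('a) - 1) \<le> ?c * (2 * R) ^ (DIM('a) - 1)" if "R \<le> r" "r < R + 2"
      using that sphere_area_pos[where 'a='a] by (intro mult_left_mono) auto
    then show "ennreal (?c * r ^ (DIM('a) - 1)) * indicator {0..} r * indicator {R..<R+2} r
        \<le> ennreal (?c * (2 * R) ^ (DIM('a) - 1)) * indicator {R..R+2} r"
      by (cases "R \<le> r \<and> r < R + 2") (auto simp: indicator_def intro!: ennreal_leI)
  qed
  also have "\<dots> = ennreal (?c * (2 * R) ^ (DIM('a) - 1)) * ennreal 2"
    by (subst nn_integral_cmult_indicator) auto
  also have "\<dots> = ennreal (?c * (2 * 2 ^ (DIM('a) - 1)) * R ^ (DIM('a) - 1))"
    using assms sphere_area_pos[where 'a='a]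
    by (subst ennreal_mult[symmetric]) (auto simp: power_mult_distrib mult_ac)
  also have "(2::real) * 2 ^ (DIM('a) - 1) = 2 ^ DIM('a)"
    by (metis DIM_positive power_eq_if not_less_zero)
  finally show ?thesis .
qed


section \<open>The growth rate, with \<open>\<sigma>\<close> standing for s p\<close>

definition growth_rate :: "real \<Rightarrow> real \<Rightarrow> real \<Rightarrow> real" where
  "growth_rate n \<sigma> R =
     (if \<sigma> < 1 then R powr (n - \<sigma>) / (1 - \<sigma>)
      else if \<sigma> = 1 then R powr (n - 1) * ln R
      else R powr (n - 1) / (\<sigma> - 1))"

text \<open>Lets surface terms be absorbed into the growth rate in all three regimes. The factor
  \<open>p + 2\<close> exceeds \<open>\<sigma>\<close> - 1, which covers the supercritical case, and
  is at least 2, which compensates for ln R being only known to be at least 1/2 in the critical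
  case.\<close>

lemma power_le_growth_rate:
  fixes R \<sigma> p :: real
  assumes "R \<ge> 2" "0 < \<sigma>" "\<sigma> < p" "p > 1" "n \<ge> 1"
  shows "R ^ (n - 1) \<le> (p + 2) * growth_rate (real n) \<sigma> R"
proof -
  have P: "R ^ (n - 1) = R powr (real n - 1)"
    using powr_power_mult[of R n 0] assms by simp
  consider "\<sigma> < 1" | "\<sigma> = 1" | "\<sigma> > 1" by linarith
  then show ?thesis
  proof cases
    case 1
    have "R powr (real n - 1) \<le> R powr (real n - \<sigma>)"
      using assms 1 by (intro powr_mono) auto
    also have "\<dots> \<le> R powr (real n - \<sigma>) / (1 - \<sigma>)"
      using assms 1 by (intro mult_imp_le_div_pos) (auto intro!: mult_left_le)
    also have "\<dots> \<le> (p + 2) * (R powr (real n - \<sigma>) / (1 - \<sigma>))"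
      using assms 1 mult_right_mono[of 1 "p + 2" "R powr (real n - \<sigma>) / (1 - \<sigma>)"] by simp
    finally show ?thesis unfolding P using 1 by (simp add: growth_rate_def)
  next
    case 2
    have "1 / 2 \<le> ln R"
      using ln2_ge_two_thirds ln_le_cancel_iff[of 2 R] assms by linarith
    then have "1 \<le> (p + 2) * ln R"
      using assms mult_mono[of 2 "p + 2" "1 / 2" "ln R"] by simp
    then have "R powr (real n - 1) * 1 \<le> R powr (real n - 1) * ((p + 2) * ln R)"
      by (intro mult_left_mono) auto
    then show ?thesis unfolding P using 2 by (simp add: growth_rate_def mult_ac)
  next
    case 3
    have "R powr (real n - 1) * 1 \<le> R powr (real n - 1) * ((p + 2) / (\<sigma> - 1))"
      using assms 3 by (intro mult_left_mono) auto
    then show ?thesis unfolding P using 3 by (simp add: growth_rate_def mult_ac)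
  qed
qed

lemma growth_rate_nonneg: "R \<ge> 2 \<Longrightarrow> growth_rate n \<sigma> R \<ge> 0"
  by (auto simp: growth_rate_def)

text \<open>The substitution t = R + 1 - r turns the integral into that of
  t^(-\<open>\<sigma>\<close>) over [1, R+1]; its primitive is where the three regimes originate.
  Starting at 1 instead of 0 keeps it finite for every \<open>\<sigma>\<close>. The factor 2 pays
  for replacing R + 1 by R.\<close>

lemma nn_integral_shifted_powr_le:
  fixes R \<sigma> :: real
  assumes "R \<ge> 2" "\<sigma> > 0" "n \<ge> 1"
  shows "ennreal (R ^ (n - 1)) * (\<integral>\<^sup>+r. ennreal ((R + 1 - r) powr (-\<sigma>)) * indicator {0..R} r \<partial>lborel)
     \<le> ennreal (2 * growth_rate (real n) \<sigma> R)"
proof -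
  have P: "R ^ (n - 1) = R powr (real n - 1)"
    using powr_power_mult[of R n 0] assms by simp
  let ?I = "\<integral>\<^sup>+r. ennreal ((R + 1 - r) powr (-\<sigma>)) * indicator {0..R} r \<partial>lborel"
  have *: ?thesis if "?I = ennreal I" "R powr (real n - 1) * I \<le> 2 * growth_rate (real n) \<sigma> R" for I
    unfolding that(1) P using that(2) by (subst ennreal_mult'[symmetric]) (auto intro: ennreal_leI)
  show ?thesis
  proof (cases "\<sigma> = 1")
    case True
    have I: "?I = ennreal (- ln (R + 1 - R) - (- ln (R + 1 - 0)))"
      using assms True
      by (intro nn_integral_FTC_Icc) (auto intro!: derivative_eq_intros simp: powr_minus divide_simps)
    have "2 * R \<le> R * R"
      using assms by (intro mult_right_mono) auto
    then have "R + 1 \<le> R ^ 2"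
      using assms unfolding power2_eq_square by linarith
    then have "ln (R + 1) \<le> ln (R ^ 2)"
      using assms by (subst ln_le_cancel_iff) auto
    also have "\<dots> = 2 * ln R" using assms by (simp add: ln_realpow)
    finally have "R powr (real n - 1) * ln (R + 1) \<le> R powr (real n - 1) * (2 * ln R)"
      by (intro mult_left_mono) auto
    with I True show ?thesis by (intro *) (auto simp: growth_rate_def)
  next
    case False
    have I: "?I = ennreal (- ((R + 1 - R) powr (1 - \<sigma>) / (1 - \<sigma>)) - (- ((R + 1 - 0) powr (1 - \<sigma>) / (1 - \<sigma>))))"
      using assms False
      by (intro nn_integral_FTC_Icc) (auto intro!: derivative_eq_intros)
    then have I': "?I = ennreal (((R + 1) powr (1 - \<sigma>) - 1) / (1 - \<sigma>))"
      by (simp add: diff_divide_distrib)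
    show ?thesis
    proof (cases "\<sigma> < 1")
      case True
      have "(R + 1) powr (1 - \<sigma>) \<le> (2 * R) powr (1 - \<sigma>)"
        using assms True by (intro powr_mono2) auto
      also have "\<dots> = 2 powr (1 - \<sigma>) * R powr (1 - \<sigma>)"
        using assms by (simp add: powr_mult)
      also have "2 powr (1 - \<sigma>) \<le> 2 powr 1"
        using assms by (intro powr_mono) auto
      finally have "(R + 1) powr (1 - \<sigma>) \<le> 2 * R powr (1 - \<sigma>)"
        by (simp add: mult_right_mono)
      then have "R powr (real n - 1) * (((R + 1) powr (1 - \<sigma>) - 1) / (1 - \<sigma>))
          \<le> R powr (real n - 1) * (2 * R powr (1 - \<sigma>) / (1 - \<sigma>))"
        using True by (intro mult_left_mono divide_right_mono) auto
      also have "\<dots> = 2 * (R powr (real n - \<sigma>) / (1 - \<sigma>))"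
        by (simp flip: powr_add)
      finally show ?thesis using I' True by (intro *) (auto simp: growth_rate_def)
    next
      case False
      with \<open>\<sigma> \<noteq> 1\<close> have "\<sigma> > 1" by simp
      have "((R + 1) powr (1 - \<sigma>) - 1) / (1 - \<sigma>) = (1 - (R + 1) powr (1 - \<sigma>)) / (\<sigma> - 1)"
        by (metis minus_diff_eq minus_divide_divide)
      also have "\<dots> \<le> 2 / (\<sigma> - 1)"
        using \<open>\<sigma> > 1\<close> by (intro divide_right_mono) (auto intro: order_trans[of _ 0])
      finally have "R powr (real n - 1) * (((R + 1) powr (1 - \<sigma>) - 1) / (1 - \<sigma>))
          \<le> R powr (real n - 1) * (2 / (\<sigma> - 1))"
        by (intro mult_left_mono) auto
      then show ?thesis using I' \<open>\<sigma> > 1\<close> by (intro *) (auto simp: growth_rate_def mult.commute)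
    qed
  qed
qed

text \<open>Bounding the Jacobian r^(n-1) by R^(n-1) reduces this to one dimension without changing
  the order of growth in any regime.\<close>

lemma nn_integral_ball_dist_powr_le:
  fixes R \<sigma> :: real
  assumes "R \<ge> 2" "\<sigma> > 0"
  shows "(\<integral>\<^sup>+(x::'a::euclidean_space). ennreal (indicator (ball 0 R) x * (R + 1 - norm x) powr (-\<sigma>)) \<partial>lborel)
     \<le> ennreal (2 * sphere_area TYPE('a) * growth_rate DIM('a) \<sigma> R)"
proof -
  let ?c = "sphere_area TYPE('a)"
  have "(\<integral>\<^sup>+(x::'a). ennreal (indicator (ball 0 R) x * (R + 1 - norm x) powr (-\<sigma>)) \<partial>lborel)
      = (\<integral>\<^sup>+(x::'a). ennreal (indicator {..<R} (norm x) * (R + 1 - norm x) powr (-\<sigma>)) \<partial>lborel)"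
    by (intro nn_integral_cong) (auto split: split_indicator)
  also have "\<dots> = (\<integral>\<^sup>+r. ennreal (?c * r ^ (DIM('a) - 1)) * indicator {0..} r *
       ennreal (indicator {..<R} r * (R + 1 - r) powr (-\<sigma>)) \<partial>lborel)"
    by (rule nn_integral_norm) measurable
  also have "\<dots> \<le> (\<integral>\<^sup>+r. ennreal (?c * R ^ (DIM('a) - 1)) *
       (ennreal ((R + 1 - r) powr (-\<sigma>)) * indicator {0..R} r) \<partial>lborel)"
    using assms sphere_area_pos[where 'a='a]
    by (intro nn_integral_mono)
       (auto intro!: mult_right_mono ennreal_leI mult_left_mono power_mono split: split_indicator)
  also have "\<dots> = ennreal (?c * R ^ (DIM('a) - 1)) *
       (\<integral>\<^sup>+r. ennreal ((R + 1 - r) powr (-\<sigma>)) * indicator {0..R} r \<partial>lborel)"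
    by (rule nn_integral_cmult) measurable
  also have "\<dots> = ennreal ?c * (ennreal (R ^ (DIM('a) - 1)) *
       (\<integral>\<^sup>+r. ennreal ((R + 1 - r) powr (-\<sigma>)) * indicator {0..R} r \<partial>lborel))"
    using assms sphere_area_pos[where 'a='a] by (simp add: ennreal_mult mult.assoc)
  also have "\<dots> \<le> ennreal ?c * ennreal (2 * growth_rate DIM('a) \<sigma> R)"
    using assms by (intro mult_left_mono nn_integral_shifted_powr_le) (auto simp: Suc_leI)
  also have "\<dots> = ennreal (2 * ?c * growth_rate DIM('a) \<sigma> R)"
    using assms sphere_area_pos[where 'a='a]
    by (subst ennreal_mult[symmetric]) (auto simp: growth_rate_nonneg mult_ac)
  finally show ?thesis .
qed

text \<open>A point outside the ball of radius r about 0 has distance at least r - |x| from x, so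
  the domain may be enlarged to the complement of a ball centred at x.\<close>

lemma nn_integral_kernel_outside_ball_le:
  fixes x :: "'a::euclidean_space" and \<sigma> r :: real
  assumes "\<sigma> > 0" "norm x < r"
  shows "(\<integral>\<^sup>+y. ennreal (indicator (- ball 0 r) y * (1 / norm (x - y) powr (DIM('a) + \<sigma>))) \<partial>lborel)
     \<le> ennreal (sphere_area TYPE('a) / \<sigma> * (r - norm x) powr (-\<sigma>))"
proof -
  define f :: "'a \<Rightarrow> ennreal" where
    "f z = ennreal (indicator {r - norm x..} (norm z) * norm z powr (- (DIM('a) + \<sigma>)))" for z
  have [measurable]: "f \<in> borel_measurable borel"
    unfolding f_def by measurable
  have "(\<integral>\<^sup>+y. ennreal (indicator (- ball 0 r) y * (1 / norm (x - y) powr (DIM('a) + \<sigma>))) \<partial>lborel)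
     \<le> (\<integral>\<^sup>+y. f (x - y) \<partial>lborel)"
  proof (intro nn_integral_mono)
    fix y
    have "r - norm x \<le> norm (x - y)" if "y \<notin> ball 0 r"
      using that norm_triangle_ineq2[of y x] by (simp add: norm_minus_commute)
    then show "ennreal (indicator (- ball 0 r) y * (1 / norm (x - y) powr (DIM('a) + \<sigma>))) \<le> f (x - y)"
      unfolding f_def powr_minus_divide by (intro ennreal_leI) (auto split: split_indicator)
  qed
  also have "\<dots> = (\<integral>\<^sup>+z. f z \<partial>lborel)"
    by (rule nn_integral_lborel_diff) measurable
  also have "\<dots> = ennreal (sphere_area TYPE('a) / \<sigma> * (r - norm x) powr (-\<sigma>))"
    unfolding f_def using assms by (subst nn_integral_norm_powr_outside_ball) auto
  finally show ?thesis .
qed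

lemma nn_integral_ball_kernel_le:
  fixes R \<sigma> :: real
  assumes "R \<ge> 2" "\<sigma> > 0"
  shows "(\<integral>\<^sup>+x. \<integral>\<^sup>+y. ennreal (indicator (ball 0 R) x * indicator (- ball 0 (R + 1)) y *
      (1 / norm (x - y) powr (DIM('a::euclidean_space) + \<sigma>))) \<partial>(lborel :: 'a measure) \<partial>lborel)
     \<le> ennreal (2 * sphere_area TYPE('a) ^ 2 / \<sigma> * growth_rate DIM('a) \<sigma> R)"
proof -
  let ?c = "sphere_area TYPE('a)"
  have [measurable]: "ball (0::'a) R \<in> sets borel"
    by simp
  have "(\<integral>\<^sup>+x. \<integral>\<^sup>+y. ennreal (indicator (ball 0 R) x * indicator (- ball 0 (R + 1)) y *
      (1 / norm (x - y) powr (DIM('a) + \<sigma>))) \<partial>(lborel :: 'a measure) \<partial>lborel)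
     \<le> (\<integral>\<^sup>+(x::'a). ennreal (?c / \<sigma>) * ennreal (indicator (ball 0 R) x * (R + 1 - norm x) powr (-\<sigma>)) \<partial>lborel)"
  proof (intro nn_integral_mono)
    fix x :: 'a
    show "(\<integral>\<^sup>+y. ennreal (indicator (ball 0 R) x * indicator (- ball 0 (R + 1)) y *
        (1 / norm (x - y) powr (DIM('a) + \<sigma>))) \<partial>lborel)
      \<le> ennreal (?c / \<sigma>) * ennreal (indicator (ball 0 R) x * (R + 1 - norm x) powr (-\<sigma>))"
    proof (cases "x \<in> ball 0 R")
      case True
      then show ?thesis
        using nn_integral_kernel_outside_ball_le[of \<sigma> x "R + 1"] assms sphere_area_pos[where 'a='a]
        by (simp flip: ennreal_mult)
    qed simp
  qed
  also have "\<dots> = ennreal (?c / \<sigma>) *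
      (\<integral>\<^sup>+(x::'a). ennreal (indicator (ball 0 R) x * (R + 1 - norm x) powr (-\<sigma>)) \<partial>lborel)"
    by (rule nn_integral_cmult) measurable
  also have "\<dots> \<le> ennreal (?c / \<sigma>) * ennreal (2 * ?c * growth_rate DIM('a) \<sigma> R)"
    using assms by (intro mult_left_mono nn_integral_ball_dist_powr_le) auto
  also have "\<dots> = ennreal (2 * ?c ^ 2 / \<sigma> * growth_rate DIM('a) \<sigma> R)"
    using assms sphere_area_pos[where 'a='a]
    by (subst ennreal_mult[symmetric]) (auto simp: growth_rate_nonneg power2_eq_square)
  finally show ?thesis .
qed

text \<open>The numerator is the Lipschitz bound for a bounded function. Below distance 1 it raises
  the exponent to p(1-s) - n, which is integrable at 0; beyond distance 1 only the tail
  remains.\<close>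

lemma nn_integral_truncated_kernel_le:
  fixes x :: "'a::euclidean_space" and s p :: real
  assumes "0 < s" "s < 1" "p > 1"
  shows "(\<integral>\<^sup>+y. ennreal (min 1 (norm (x - y)) powr p / norm (x - y) powr (DIM('a) + s * p)) \<partial>lborel)
     \<le> ennreal (sphere_area TYPE('a) * (1 / (p * (1 - s)) + 1 / (s * p)))"
proof -
  let ?c = "sphere_area TYPE('a)"
  define f :: "'a \<Rightarrow> ennreal" where
    "f z = ennreal (indicator {0<..1} (norm z) * norm z powr (p * (1 - s) - DIM('a)))" for z
  define g :: "'a \<Rightarrow> ennreal" where
    "g z = ennreal (indicator {1..} (norm z) * norm z powr (- (DIM('a) + s * p)))" for z
  have [measurable]: "f \<in> borel_measurable borel" "g \<in> borel_measurable borel"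
    unfolding f_def g_def by measurable
  have "ennreal (min 1 (norm z) powr p / norm z powr (DIM('a) + s * p)) \<le> f z + g z" for z
  proof (cases "norm z < 1")
    case True
    then have "min 1 (norm z) powr p / norm z powr (DIM('a) + s * p)
        = indicator {0<..1} (norm z) * norm z powr (p * (1 - s) - DIM('a))"
      by (auto simp: algebra_simps simp flip: powr_diff split: split_indicator)
    then have "ennreal (min 1 (norm z) powr p / norm z powr (DIM('a) + s * p)) = f z"
      by (simp add: f_def)
    then show ?thesis by simp
  next
    case False
    then have "min 1 (norm z) = 1" by simp
    with False have "ennreal (min 1 (norm z) powr p / norm z powr (DIM('a) + s * p)) = g z"
      unfolding g_def powr_minus_divide by simp
    then show ?thesis by simp
  qed
  then have "(\<integral>\<^sup>+y. ennreal (min 1 (norm (x - y)) powr p / norm (x - y) powr (DIM('a) + s * p)) \<partial>lborel)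
     \<le> (\<integral>\<^sup>+y. f (x - y) + g (x - y) \<partial>lborel)"
    by (intro nn_integral_mono) auto
  also have "\<dots> = (\<integral>\<^sup>+z. f z + g z \<partial>lborel)"
    using nn_integral_lborel_diff[of "\<lambda>z. f z + g z" x] by simp
  also have "\<dots> = (\<integral>\<^sup>+z. f z \<partial>lborel) + (\<integral>\<^sup>+z. g z \<partial>lborel)"
    by (rule nn_integral_add) auto
  also have "\<dots> = ennreal (?c / (p * (1 - s))) + ennreal (?c * 1 powr (- (s * p)) / (s * p))"
    unfolding f_def g_def using assms
    by (subst nn_integral_norm_powr_unit_ball, simp, subst nn_integral_norm_powr_outside_ball) auto
  also have "\<dots> = ennreal (?c * (1 / (p * (1 - s)) + 1 / (s * p)))"
    using assms sphere_area_pos[where 'a='a] by (simp add: algebra_simps flip: ennreal_plus)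
  finally show ?thesis .
qed

subsection \<open>Nonlocal energies\<close>

lemma sigma_finite_lebesgue: "sigma_finite_measure (lebesgue :: 'a::euclidean_space measure)"
proof
  obtain A :: "'a set set" where A: "countable A" "A \<subseteq> sets lborel" "\<Union>A = space lborel"
      "\<forall>a\<in>A. emeasure lborel a \<noteq> \<infinity>"
    using sigma_finite_measure.sigma_finite_countable[OF sigma_finite_lborel] by blast
  have "emeasure lebesgue a \<noteq> \<infinity>" if "a \<in> A" for a
    using that A by (simp add: subset_iff)
  with A show "\<exists>A::'a set set. countable A \<and> A \<subseteq> sets lebesgue \<and> \<Union>A = space lebesgue \<and>
      (\<forall>a\<in>A. emeasure lebesgue a \<noteq> \<infinity>)"
    by (intro exI[of _ A]) auto
qed

text \<open>The two sets are kept independent so that interactions between different regions can be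
  split, enlarged and compared separately.\<close>

definition gagliardo :: "real \<Rightarrow> real \<Rightarrow> ('a::euclidean_space \<Rightarrow> real) \<Rightarrow> 'a set \<Rightarrow> 'a set \<Rightarrow> ennreal" where
  "gagliardo p s u A B = (\<integral>\<^sup>+ x. \<integral>\<^sup>+ y. ennreal (indicator A x * indicator B y *
          (\<bar>u x - u y\<bar> powr p / norm (x - y) powr (real DIM('a) + s * p))) \<partial>lebesgue \<partial>lebesgue)"

lemma Kps_gagliardo: "Kps p s u A = (1/2) * gagliardo p s u A A + gagliardo p s u A (- A)"
  by (simp add: Kps_def gagliardo_def)

lemma gagliardo_mono:
  assumes "A \<subseteq> A'" "B \<subseteq> B'"
  shows "gagliardo p s u A B \<le> gagliardo p s u A' B'"
  unfolding gagliardo_def using assms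
  by (intro nn_integral_mono ennreal_leI mult_right_mono) (auto split: split_indicator)

lemma gagliardo_empty: "gagliardo p s u {} {} = 0"
  by (simp add: gagliardo_def)

lemma measurable_gagliardo_kernel:
  fixes u :: "'a::euclidean_space \<Rightarrow> real"
  assumes [measurable]: "u \<in> borel_measurable lebesgue" "A \<in> sets lebesgue" "B \<in> sets lebesgue"
  shows "(\<lambda>(x, y). ennreal (indicator A x * indicator B y *
          (\<bar>u x - u y\<bar> powr p / norm (x - y) powr (real DIM('a) + s * p))))
     \<in> borel_measurable (lebesgue \<Otimes>\<^sub>M lebesgue)"
proof -
  \<comment> \<open>Reading the projections as Borel-valued maps makes norm(x - y) measurable on the
    product of the completed measures.\<close>
  have id: "(\<lambda>x::'a. x) \<in> lebesgue \<rightarrow>\<^sub>M borel"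
    by (simp add: measurable_completion)
  have [measurable]: "(\<lambda>z. fst z) \<in> lebesgue \<Otimes>\<^sub>M lebesgue \<rightarrow>\<^sub>M (borel :: 'a measure)"
     "(\<lambda>z. snd z) \<in> lebesgue \<Otimes>\<^sub>M lebesgue \<rightarrow>\<^sub>M (borel :: 'a measure)"
    using measurable_compose[OF measurable_fst id] measurable_compose[OF measurable_snd id] by auto
  have [measurable]: "(\<lambda>z. norm (fst z - snd z)) \<in> borel_measurable (lebesgue \<Otimes>\<^sub>M (lebesgue :: 'a measure))"
    by measurable
  show ?thesis
    unfolding case_prod_beta by measurable
qed

text \<open>As a single integral over the product, the energy is additive from joint measurability
  alone, with no separate argument for the inner integrals.\<close>

lemma gagliardo_pair_measure:
  fixes u :: "'a::euclidean_space \<Rightarrow> real"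
  assumes "u \<in> borel_measurable lebesgue" "A \<in> sets lebesgue" "B \<in> sets lebesgue"
  shows "gagliardo p s u A B = (\<integral>\<^sup>+ (x, y). ennreal (indicator A x * indicator B y *
          (\<bar>u x - u y\<bar> powr p / norm (x - y) powr (real DIM('a) + s * p))) \<partial>(lebesgue \<Otimes>\<^sub>M lebesgue))"
  unfolding gagliardo_def
  using sigma_finite_measure.nn_integral_fst[OF sigma_finite_lebesgue measurable_gagliardo_kernel[OF assms]]
  by simp

text \<open>Both sides are sums because extended nonnegative quantities do not subtract well; the
  cancellation is postponed until finiteness is known. Outside A \<times> B every term vanishes,
  since C lies in both sets.\<close>

lemma gagliardo_add_le:
  fixes u v w :: "'a::euclidean_space \<Rightarrow> real"
  assumes meas: "u \<in> borel_measurable lebesgue" "v \<in> borel_measurable lebesgue" "w \<in> borel_measurable lebesgue"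
    and sets: "A \<in> sets lebesgue" "B \<in> sets lebesgue" "C \<in> sets lebesgue"
    and le: "\<And>x y. x \<in> A \<Longrightarrow> y \<in> B \<Longrightarrow>
       \<bar>v x - v y\<bar> powr p + indicator C x * indicator C y * \<bar>u x - u y\<bar> powr p
         \<le> \<bar>u x - u y\<bar> powr p + \<bar>w x - w y\<bar> powr p"
    and C: "C \<subseteq> A" "C \<subseteq> B"
  shows "gagliardo p s v A B + gagliardo p s u C C \<le> gagliardo p s u A B + gagliardo p s w A B"
  unfolding gagliardo_pair_measure[OF meas(1) sets(1,2)] gagliardo_pair_measure[OF meas(2) sets(1,2)]
    gagliardo_pair_measure[OF meas(3) sets(1,2)] gagliardo_pair_measure[OF meas(1) sets(3,3)]
proof (subst (1 2) nn_integral_add[symmetric], (intro measurable_gagliardo_kernel meas sets)+,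
    intro nn_integral_mono, clarify)
  fix x y :: 'a
  define k where "k = 1 / norm (x - y) powr (real DIM('a) + s * p)"
  have k: "k \<ge> 0" "t / norm (x - y) powr (real DIM('a) + s * p) = t * k" for t
    by (auto simp: k_def)
  show "ennreal (indicator A x * indicator B y * (\<bar>v x - v y\<bar> powr p / norm (x - y) powr (real DIM('a) + s * p)))
      + ennreal (indicator C x * indicator C y * (\<bar>u x - u y\<bar> powr p / norm (x - y) powr (real DIM('a) + s * p)))
    \<le> ennreal (indicator A x * indicator B y * (\<bar>u x - u y\<bar> powr p / norm (x - y) powr (real DIM('a) + s * p)))
      + ennreal (indicator A x * indicator B y * (\<bar>w x - w y\<bar> powr p / norm (x - y) powr (real DIM('a) + s * p)))"
  proof (cases "x \<in> A \<and> y \<in> B")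
    case True
    then show ?thesis
      unfolding k using mult_right_mono[OF le k(1), of x y] k(1)
      by (simp add: algebra_simps flip: ennreal_plus)
  next
    case False
    then have "indicator A x * indicator B y = (0::real)" "indicator C x * indicator C y = (0::real)"
      using C by (auto simp: indicator_def)
    then show ?thesis by (simp only: mult_zero_left)
  qed
qed

text \<open>Pairs at which u takes equal values have zero integrand, so two rectangles need to cover
  only the remaining pairs.\<close>

lemma gagliardo_split_le:
  fixes u :: "'a::euclidean_space \<Rightarrow> real"
  assumes meas: "u \<in> borel_measurable lebesgue"
    and sets: "A \<in> sets lebesgue" "B \<in> sets lebesgue" "A1 \<in> sets lebesgue" "B1 \<in> sets lebesgue"
      "A2 \<in> sets lebesgue" "B2 \<in> sets lebesgue"
    and cover: "\<And>x y. x \<in> A \<Longrightarrow> y \<in> B \<Longrightarrow> x \<in> A1 \<and> y \<in> B1 \<or> x \<in> A2 \<and> y \<in> B2 \<or> u x = u y"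
  shows "gagliardo p s u A B \<le> gagliardo p s u A1 B1 + gagliardo p s u A2 B2"
  unfolding gagliardo_pair_measure[OF meas sets(1,2)] gagliardo_pair_measure[OF meas sets(3,4)]
    gagliardo_pair_measure[OF meas sets(5,6)]
proof (subst nn_integral_add[symmetric], (intro measurable_gagliardo_kernel meas sets)+,
    intro nn_integral_mono, clarify)
  fix x y :: 'a
  show "ennreal (indicator A x * indicator B y * (\<bar>u x - u y\<bar> powr p / norm (x - y) powr (real DIM('a) + s * p)))
    \<le> ennreal (indicator A1 x * indicator B1 y * (\<bar>u x - u y\<bar> powr p / norm (x - y) powr (real DIM('a) + s * p)))
      + ennreal (indicator A2 x * indicator B2 y * (\<bar>u x - u y\<bar> powr p / norm (x - y) powr (real DIM('a) + s * p)))"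
    using cover[of x y] by (auto simp: indicator_def simp flip: ennreal_plus)
qed

lemma gagliardo_ball_complement_le:
  fixes u :: "'a::euclidean_space \<Rightarrow> real" and p s R :: real
  assumes u: "AE x in lebesgue. \<bar>u x\<bar> \<le> 1" and "p > 1" "s > 0" "R \<ge> 2"
  shows "gagliardo p s u (ball 0 R) (- ball 0 (R + 1))
    \<le> ennreal (2 powr p * (2 * sphere_area TYPE('a) ^ 2 / (s * p) * growth_rate DIM('a) (s * p) R))"
proof -
  let ?k = "\<lambda>x y::'a. indicator (ball 0 R) x * indicator (- ball 0 (R + 1)) y *
      (1 / norm (x - y) powr (DIM('a) + s * p)) :: real"
  have [measurable]: "ball (0::'a) R \<in> sets borel" "- ball (0::'a) (R + 1) \<in> sets borel"
    by auto
  have "gagliardo p s u (ball 0 R) (- ball 0 (R + 1))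
    \<le> (\<integral>\<^sup>+x. ennreal (2 powr p) * (\<integral>\<^sup>+y. ennreal (?k x y) \<partial>lebesgue) \<partial>lebesgue)"
    unfolding gagliardo_def
  proof (rule nn_integral_mono_AE, use u in eventually_elim)
    case (elim x)
    have "(\<integral>\<^sup>+ y. ennreal (indicator (ball 0 R) x * indicator (- ball 0 (R + 1)) y *
         (\<bar>u x - u y\<bar> powr p / norm (x - y) powr (real DIM('a) + s * p))) \<partial>lebesgue)
      \<le> (\<integral>\<^sup>+y. ennreal (2 powr p) * ennreal (?k x y) \<partial>lebesgue)"
    proof (rule nn_integral_mono_AE, use u in eventually_elim)
      case (elim y)
      then have "\<bar>u x - u y\<bar> powr p \<le> 2 powr p"
        using \<open>\<bar>u x\<bar> \<le> 1\<close> \<open>p > 1\<close> by (intro powr_mono2) auto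
      then show ?case
        by (subst ennreal_mult[symmetric])
           (auto intro!: ennreal_leI divide_right_mono split: split_indicator)
    qed
    also have "\<dots> = ennreal (2 powr p) * (\<integral>\<^sup>+y. ennreal (?k x y) \<partial>lborel)"
      unfolding nn_integral_completion by (rule nn_integral_cmult) measurable
    finally show ?case by (simp only: nn_integral_completion)
  qed
  also have "\<dots> = ennreal (2 powr p) * (\<integral>\<^sup>+x. \<integral>\<^sup>+y. ennreal (?k x y) \<partial>lborel \<partial>lborel)"
    unfolding nn_integral_completion by (rule nn_integral_cmult) measurable
  also have "\<dots> \<le> ennreal (2 powr p) *
      ennreal (2 * sphere_area TYPE('a) ^ 2 / (s * p) * growth_rate DIM('a) (s * p) R)"
    using assms by (intro mult_left_mono nn_integral_ball_kernel_le) auto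
  finally show ?thesis
    by (subst ennreal_mult') auto
qed

section \<open>The comparison function\<close>

definition cutoff :: "real \<Rightarrow> 'a::euclidean_space \<Rightarrow> real" where
  "cutoff R x = -1 + 2 * min 1 (max 0 (norm x - (R + 1)))"

lemma cutoff_bounds: "\<bar>cutoff R x\<bar> \<le> 1"
  by (auto simp: cutoff_def min_def max_def)

lemma cutoff_inside: "x \<in> ball 0 (R + 1) \<Longrightarrow> cutoff R x = -1"
  by (simp add: cutoff_def)

lemma cutoff_outside: "x \<notin> ball 0 (R + 2) \<Longrightarrow> cutoff R x = 1"
  by (simp add: cutoff_def)

text \<open>The function rises by 2 across a shell of width 1, so 2 is both its slope and its total
  oscillation.\<close>

lemma cutoff_Lipschitz: "\<bar>cutoff R x - cutoff R y\<bar> \<le> 2 * min 1 (norm (x - y))"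
proof -
  have "norm x \<le> norm y + norm (x - y)" "norm y \<le> norm x + norm (x - y)"
    using norm_triangle_ineq3[of x y] by linarith+
  then show ?thesis
    unfolding cutoff_def min_def max_def by (auto split: if_splits)
qed

lemma borel_measurable_cutoff: "cutoff R \<in> borel_measurable borel"
  unfolding cutoff_def[abs_def] by measurable

lemma gagliardo_cutoff_shell_le:
  fixes p s R :: real
  assumes "p > 1" "0 < s" "s < 1" "R \<ge> 2"
  shows "gagliardo p s (cutoff R) (ball (0::'a::euclidean_space) (R + 2) - ball 0 R) UNIV
    \<le> ennreal (2 powr p * (sphere_area TYPE('a) * (1 / (p * (1 - s)) + 1 / (s * p)))
        * (sphere_area TYPE('a) * 2 ^ DIM('a) * R ^ (DIM('a) - 1)))"
proof -
  let ?S = "ball (0::'a) (R + 2) - ball 0 R"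
  let ?c = "sphere_area TYPE('a) * (1 / (p * (1 - s)) + 1 / (s * p))"
  have c: "?c \<ge> 0"
    using assms sphere_area_pos[where 'a='a] by (intro mult_nonneg_nonneg add_nonneg_nonneg) auto
  have "gagliardo p s (cutoff R) ?S UNIV \<le> (\<integral>\<^sup>+x. ennreal (2 powr p * ?c) * indicator ?S x \<partial>lborel)"
    unfolding gagliardo_def nn_integral_completion
  proof (rule nn_integral_mono)
    fix x :: 'a
    show "(\<integral>\<^sup>+ y. ennreal (indicator ?S x * indicator UNIV y *
        (\<bar>cutoff R x - cutoff R y\<bar> powr p / norm (x - y) powr (real DIM('a) + s * p))) \<partial>lborel)
      \<le> ennreal (2 powr p * ?c) * indicator ?S x"
    proof (cases "x \<in> ?S")
      case True
      have "\<bar>cutoff R x - cutoff R y\<bar> powr p \<le> 2 powr p * min 1 (norm (x - y)) powr p" for y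
      proof -
        have "\<bar>cutoff R x - cutoff R y\<bar> powr p \<le> (2 * min 1 (norm (x - y))) powr p"
          using assms by (intro powr_mono2 cutoff_Lipschitz) auto
        then show ?thesis by (simp add: powr_mult)
      qed
      then have "(\<integral>\<^sup>+ y. ennreal (indicator ?S x * indicator UNIV y *
        (\<bar>cutoff R x - cutoff R y\<bar> powr p / norm (x - y) powr (real DIM('a) + s * p))) \<partial>lborel)
        \<le> (\<integral>\<^sup>+ y. ennreal (2 powr p) *
          ennreal (min 1 (norm (x - y)) powr p / norm (x - y) powr (real DIM('a) + s * p)) \<partial>lborel)"
        using True by (intro nn_integral_mono)
          (auto intro!: ennreal_leI divide_right_mono simp flip: ennreal_mult)
      also have "\<dots> = ennreal (2 powr p) * (\<integral>\<^sup>+ y.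
          ennreal (min 1 (norm (x - y)) powr p / norm (x - y) powr (real DIM('a) + s * p)) \<partial>lborel)"
        by (rule nn_integral_cmult) measurable
      also have "\<dots> \<le> ennreal (2 powr p) * ennreal ?c"
        using assms by (intro mult_left_mono nn_integral_truncated_kernel_le) auto
      finally show ?thesis
        using True c by (simp add: ennreal_mult)
    qed simp
  qed
  also have "\<dots> = ennreal (2 powr p * ?c) * emeasure lborel ?S"
    by (rule nn_integral_cmult_indicator) simp
  also have "\<dots> \<le> ennreal (2 powr p * ?c) *
      ennreal (sphere_area TYPE('a) * 2 ^ DIM('a) * R ^ (DIM('a) - 1))"
    using assms by (intro mult_left_mono emeasure_shell_le) auto
  also have "\<dots> = ennreal (2 powr p * ?c * (sphere_area TYPE('a) * 2 ^ DIM('a) * R ^ (DIM('a) - 1)))"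
    using assms c sphere_area_pos[where 'a='a] by (subst ennreal_mult) auto
  finally show ?thesis .
qed

section \<open>The potential term\<close>

text \<open>Superlevel sets at levels a \<ge> 0 are relatively open in the interval. At negative
  levels they are the whole line, because W is nonnegative on the interval and the extension is 0
  elsewhere.\<close>

lemma borel_measurable_lsc_on_interval:
  assumes lsc: "lsc_on_interval W" and nonneg: "\<And>x. x \<in> {-1..1} \<Longrightarrow> W x \<ge> 0"
  shows "(\<lambda>x. if x \<in> {-1..1} then W x else 0) \<in> borel_measurable borel"
proof (subst borel_measurable_iff_greater, intro allI)
  fix a :: real
  let ?S = "{x \<in> {-1..1}. a < W x}"
  have "{w. a < (if w \<in> {-1..1} then W w else 0)} \<in> sets borel"
  proof (cases "a \<ge> 0")
    case True
    have "?S = {-1..1} \<inter> \<Union>{T. open T \<and> T \<inter> {-1..1} \<subseteq> ?S}" (is "_ = _ \<inter> ?U")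
    proof (rule set_eqI, rule iffI)
      fix x assume x: "x \<in> ?S"
      with lsc obtain e where "e > 0" "\<And>y. y \<in> {-1..1} \<Longrightarrow> \<bar>y - x\<bar> < e \<Longrightarrow> a < W y"
        unfolding lsc_on_interval_def by blast
      then have "ball x e \<inter> {-1..1} \<subseteq> ?S" "x \<in> ball x e"
        by (auto simp: dist_real_def abs_minus_commute)
      with x show "x \<in> {-1..1} \<inter> ?U" by blast
    qed auto
    moreover have "open ?U" by auto
    ultimately have "?S \<in> sets borel"
      by (metis (no_types, lifting) borel_closed borel_open closed_atLeastAtMost sets.Int)
    moreover have "{w. a < (if w \<in> {-1..1} then W w else 0)} = ?S"
      using True by auto
    ultimately show ?thesis by simp
  next
    case False
    then have "a < (if w \<in> {-1..1} then W w else 0)" for w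
      using nonneg[of w] by (cases "w \<in> {-1..1}") auto
    then have "{w. a < (if w \<in> {-1..1} then W w else 0)} = UNIV"
      by blast
    then show ?thesis by simp
  qed
  then show "{w \<in> space borel. a < (if w \<in> {-1..1} then W w else 0)} \<in> sets borel"
    by simp
qed

lemma potential_add_le:
  fixes u v w :: "'a::euclidean_space \<Rightarrow> real"
  assumes lsc: "lsc_on_interval W" and nonneg: "\<And>x. x \<in> {-1..1} \<Longrightarrow> W x \<ge> 0"
    and meas: "u \<in> borel_measurable lebesgue" "v \<in> borel_measurable lebesgue" "w \<in> borel_measurable lebesgue"
    and bounds: "AE x in lebesgue. \<bar>u x\<bar> \<le> 1" "AE x in lebesgue. \<bar>v x\<bar> \<le> 1" "AE x in lebesgue. \<bar>w x\<bar> \<le> 1"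
    and sets: "A \<in> sets lebesgue" "C \<in> sets lebesgue" "C \<subseteq> A"
    and le: "AE x in lebesgue. x \<in> A \<longrightarrow> W (v x) + indicator C x * W (u x) \<le> W (u x) + W (w x)"
  shows "(\<integral>\<^sup>+x. ennreal (indicator A x * W (v x)) \<partial>lebesgue) + (\<integral>\<^sup>+x. ennreal (indicator C x * W (u x)) \<partial>lebesgue)
     \<le> (\<integral>\<^sup>+x. ennreal (indicator A x * W (u x)) \<partial>lebesgue) + (\<integral>\<^sup>+x. ennreal (indicator A x * W (w x)) \<partial>lebesgue)"
proof -
  \<comment> \<open>Nothing is known about W off [-1, 1]. All functions inserted stay in that
    interval almost everywhere, so the Borel function V may replace W.\<close>
  define V where "V x = (if x \<in> {-1..1} then W x else 0)" for x
  have [measurable]: "V \<in> borel_measurable borel"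
    unfolding V_def[abs_def] by (intro borel_measurable_lsc_on_interval lsc nonneg)
  note [measurable] = meas sets(1,2)
  have V: "(\<integral>\<^sup>+x. ennreal (indicator B x * W (f x)) \<partial>lebesgue) = (\<integral>\<^sup>+x. ennreal (indicator B x * V (f x)) \<partial>lebesgue)"
    if "AE x in lebesgue. \<bar>f x\<bar> \<le> 1" for f :: "'a \<Rightarrow> real" and B
    by (rule nn_integral_cong_AE, use that in eventually_elim) (auto simp: V_def)
  have "AE x in lebesgue. ennreal (indicator A x * V (v x)) + ennreal (indicator C x * V (u x))
     \<le> ennreal (indicator A x * V (u x)) + ennreal (indicator A x * V (w x))"
    using bounds le
  proof eventually_elim
    case (elim x)
    then show ?case
      using sets(3) nonneg by (auto simp: V_def abs_le_iff indicator_def simp flip: ennreal_plus)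
  qed
  then show ?thesis
    unfolding V[OF bounds(1)] V[OF bounds(2)] V[OF bounds(3)]
    by (subst (1 2) nn_integral_add[symmetric]) (auto intro!: nn_integral_mono_AE)
qed


text \<open>At -1 the upper growth bound is a power of 0, hence 0; on the interval, 1 + x is at most
  2.\<close>

lemma W1_bounds:
  assumes "W1 W lam Lam theta m" "Lam \<ge> 1" "m \<ge> 0"
  shows "W (-1) \<le> 0" "x \<in> {-1..1} \<Longrightarrow> W x \<le> Lam * 2 powr m"
proof -
  show "W (-1) \<le> 0"
    using assms(1) unfolding W1_def by (auto dest!: bspec[of _ _ "-1"])
  assume x: "x \<in> {-1..1}"
  then have "W x \<le> Lam * \<bar>1 + x\<bar> powr m"
    using assms(1) unfolding W1_def by auto
  also have "\<dots> \<le> Lam * 2 powr m"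
    using x assms by (intro mult_left_mono powr_mono2) auto
  finally show "W x \<le> Lam * 2 powr m" .
qed

lemma divide_le_numerator:
  fixes x p :: real
  assumes "x \<ge> 0" "p \<ge> 1"
  shows "x / p \<le> x"
  using assms mult_left_mono[of 1 p x] by (simp add: divide_le_eq)

section \<open>The energy of the comparison function\<close>

lemma Kps_cutoff_le:
  fixes p s R :: real
  assumes "p > 1" "0 < s" "s < 1" "R \<ge> 2"
  defines "c \<equiv> sphere_area TYPE('a::euclidean_space)" and "T \<equiv> growth_rate DIM('a) (s * p) R"
  shows "Kps p s (cutoff R) (ball (0::'a) (R + 2)) < \<infinity>"
    and "ennreal (1 - s) * Kps p s (cutoff R) (ball (0::'a) (R + 2))
      \<le> ennreal (2 * (2 powr p * 2 * c ^ 2 + 2 powr p * c ^ 2 * 2 ^ DIM('a) * (p + 2)) / s * T)"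
proof -
  let ?\<Omega> = "ball (0::'a) (R + 2)" and ?S = "ball (0::'a) (R + 2) - ball 0 R"
  let ?g = "gagliardo p s (cutoff R :: 'a \<Rightarrow> real)"
  define X where "X = 2 powr p * (2 * c ^ 2 / (s * p) * T)"
  define Y where "Y = 2 powr p * (c * (1 / (p * (1 - s)) + 1 / (s * p))) * (c * 2 ^ DIM('a) * R ^ (DIM('a) - 1))"
  have c: "c > 0" unfolding c_def by (rule sphere_area_pos)
  have T: "T \<ge> 0" unfolding T_def using assms by (intro growth_rate_nonneg)
  have meas: "(cutoff R :: 'a \<Rightarrow> real) \<in> borel_measurable lebesgue"
    by (intro measurable_completion) (simp add: borel_measurable_cutoff)
  have nonneg: "X \<ge> 0" "Y \<ge> 0"
    unfolding X_def Y_def using assms(1-4) c T by (auto intro!: mult_nonneg_nonneg add_nonneg_nonneg)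
  \<comment> \<open>For x in B_R and y in B_{R+1} both values are -1, so only far points y, or
    points x in the shell, contribute.\<close>
  have "?g ?\<Omega> UNIV \<le> ?g (ball 0 R) (- ball 0 (R + 1)) + ?g ?S UNIV"
    by (rule gagliardo_split_le[OF meas]) (auto simp: cutoff_inside)
  also have "?g (ball 0 R) (- ball 0 (R + 1)) \<le> ennreal X"
    unfolding X_def c_def T_def using assms
    by (intro gagliardo_ball_complement_le) (auto simp: cutoff_bounds)
  also have "?g ?S UNIV \<le> ennreal Y"
    unfolding Y_def c_def using assms by (intro gagliardo_cutoff_shell_le)
  finally have g: "?g ?\<Omega> UNIV \<le> ennreal (X + Y)"
    using nonneg by (simp add: add_mono)
  have half: "(1/2) * t \<le> t" for t :: ennreal
    using mult_right_mono[of "1/2" 1 t] by (simp add: divide_le_posI_ennreal)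
  have "Kps p s (cutoff R) ?\<Omega> \<le> ?g ?\<Omega> UNIV + ?g ?\<Omega> UNIV"
    unfolding Kps_gagliardo by (intro add_mono order.trans[OF half] gagliardo_mono) auto
  also have "\<dots> \<le> ennreal (X + Y) + ennreal (X + Y)"
    by (intro add_mono g)
  also have "\<dots> = ennreal (2 * (X + Y))"
    using nonneg by (simp flip: ennreal_plus)
  finally have K: "Kps p s (cutoff R) ?\<Omega> \<le> ennreal (2 * (X + Y))" .
  then show "Kps p s (cutoff R) ?\<Omega> < \<infinity>"
    by (rule le_less_trans) simp
  have "(1 - s) * X \<le> X"
    using mult_right_mono[of "1 - s" 1 X] assms nonneg by simp
  also have "X = 2 powr p * 2 * c ^ 2 * T / s / p"
    by (simp add: X_def)
  also have "\<dots> \<le> 2 powr p * 2 * c ^ 2 * T / s"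
    using assms(1-4) c T by (intro divide_le_numerator) auto
  finally have X: "(1 - s) * X \<le> 2 powr p * 2 * c ^ 2 / s * T" by simp
  have "(1 - s) * Y = 2 powr p * c ^ 2 * 2 ^ DIM('a) * R ^ (DIM('a) - 1) *
      ((1 - s) * (1 / (p * (1 - s)) + 1 / (s * p)))"
    unfolding Y_def power2_eq_square by (simp only: mult_ac)
  \<comment> \<open>The weight turns the two contributions into 1/p + (1-s)/(s p), which is exactly
    1/(s p): the blow-up as s tends to 1 disappears.\<close>
  also have "(1 - s) * (1 / (p * (1 - s)) + 1 / (s * p)) = 1 / (s * p)"
    using assms(1-4) by (simp add: field_simps)
  also have "2 powr p * c ^ 2 * 2 ^ DIM('a) * R ^ (DIM('a) - 1) * (1 / (s * p))
      = 2 powr p * c ^ 2 * 2 ^ DIM('a) * R ^ (DIM('a) - 1) / s / p"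
    by simp
  also have "\<dots> \<le> 2 powr p * c ^ 2 * 2 ^ DIM('a) * R ^ (DIM('a) - 1) / s"
    using assms(1-4) c by (intro divide_le_numerator) auto
  also have "\<dots> \<le> 2 powr p * c ^ 2 * 2 ^ DIM('a) * ((p + 2) * T) / s"
    unfolding T_def using assms(1-4) c
    by (intro divide_right_mono mult_left_mono power_le_growth_rate) (auto simp: Suc_leI)
  finally have Y: "(1 - s) * Y \<le> 2 powr p * c ^ 2 * 2 ^ DIM('a) * (p + 2) / s * T" by simp
  have "ennreal (1 - s) * Kps p s (cutoff R) ?\<Omega> \<le> ennreal (1 - s) * ennreal (2 * (X + Y))"
    by (intro mult_left_mono K) auto
  also have "\<dots> = ennreal (2 * ((1 - s) * X + (1 - s) * Y))"
    using assms nonneg by (subst ennreal_mult[symmetric]) (auto simp: algebra_simps)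
  also have "\<dots> \<le> ennreal (2 * (2 powr p * 2 * c ^ 2 + 2 powr p * c ^ 2 * 2 ^ DIM('a) * (p + 2)) / s * T)"
  proof (rule ennreal_leI)
    have "2 * ((1 - s) * X + (1 - s) * Y) \<le> 2 * (2 powr p * 2 * c ^ 2 / s * T + 2 powr p * c ^ 2 * 2 ^ DIM('a) * (p + 2) / s * T)"
      by (intro mult_left_mono add_mono X Y) simp
    also have "\<dots> = 2 * (2 powr p * 2 * c ^ 2 + 2 powr p * c ^ 2 * 2 ^ DIM('a) * (p + 2)) / s * T"
      by (simp only: distrib_left distrib_right add_divide_distrib times_divide_eq_left times_divide_eq_right mult.assoc)
    finally show "2 * ((1 - s) * X + (1 - s) * Y) \<le> 2 * (2 powr p * 2 * c ^ 2 + 2 powr p * c ^ 2 * 2 ^ DIM('a) * (p + 2)) / s * T" .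
  qed
  finally show "ennreal (1 - s) * Kps p s (cutoff R) ?\<Omega>
      \<le> ennreal (2 * (2 powr p * 2 * c ^ 2 + 2 powr p * c ^ 2 * 2 ^ DIM('a) * (p + 2)) / s * T)" .
qed

lemma potential_cutoff_le:
  fixes p s R :: real
  assumes "p > 1" "0 < s" "s < 1" "R \<ge> 2" and W: "W1 W lam Lam theta m" "Lam \<ge> 1" "m \<ge> 0"
  defines "c \<equiv> sphere_area TYPE('a::euclidean_space)" and "T \<equiv> growth_rate DIM('a) (s * p) R"
  shows "(\<integral>\<^sup>+x. ennreal (indicator (ball (0::'a) (R + 2)) x * W (cutoff R x)) \<partial>lebesgue)
      \<le> ennreal (Lam * 2 powr m * c * 2 ^ DIM('a) * (p + 2) / s * T)"
proof -
  let ?\<Omega> = "ball (0::'a) (R + 2)" and ?S = "ball (0::'a) (R + 2) - ball 0 R"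
  have c: "c > 0" unfolding c_def by (rule sphere_area_pos)
  have T: "T \<ge> 0" unfolding T_def using assms by (intro growth_rate_nonneg)
  have "(\<integral>\<^sup>+x. ennreal (indicator ?\<Omega> x * W (cutoff R x)) \<partial>lebesgue)
    \<le> (\<integral>\<^sup>+x. ennreal (Lam * 2 powr m) * indicator ?S x \<partial>lborel)"
    unfolding nn_integral_completion
  proof (rule nn_integral_mono)
    fix x :: 'a
    show "ennreal (indicator ?\<Omega> x * W (cutoff R x)) \<le> ennreal (Lam * 2 powr m) * indicator ?S x"
    proof (cases "x \<in> ball 0 R")
      case True
      then have "ennreal (W (cutoff R x)) = 0"
        using W1_bounds(1)[OF W] by (subst cutoff_inside) (auto intro: ennreal_neg)
      then show ?thesis by (simp add: indicator_def)
    next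
      case False
      have "W (cutoff R x) \<le> Lam * 2 powr m"
        using cutoff_bounds[of R x] by (intro W1_bounds(2)[OF W]) (auto simp: abs_le_iff)
      with False show ?thesis by (auto simp: indicator_def intro: ennreal_leI)
    qed
  qed
  also have "\<dots> = ennreal (Lam * 2 powr m) * emeasure lborel ?S"
    by (rule nn_integral_cmult_indicator) simp
  also have "\<dots> \<le> ennreal (Lam * 2 powr m) * ennreal (c * 2 ^ DIM('a) * R ^ (DIM('a) - 1))"
    unfolding c_def using assms by (intro mult_left_mono emeasure_shell_le) auto
  also have "\<dots> = ennreal (Lam * 2 powr m * c * 2 ^ DIM('a) * R ^ (DIM('a) - 1))"
    using assms(1-7) c by (subst ennreal_mult[symmetric]) (auto simp: mult_ac)
  also have "\<dots> \<le> ennreal (Lam * 2 powr m * c * 2 ^ DIM('a) * (p + 2) / s * T)"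
  proof (rule ennreal_leI)
    have "Lam * 2 powr m * c * 2 ^ DIM('a) * R ^ (DIM('a) - 1)
        \<le> Lam * 2 powr m * c * 2 ^ DIM('a) * ((p + 2) * T)"
      unfolding T_def using assms(1-7) c
      by (intro mult_left_mono power_le_growth_rate) (auto simp: Suc_leI)
    \<comment> \<open>Division by s < 1 only enlarges the bound and gives it the same shape as the
      kinetic one.\<close>
    also have "\<dots> \<le> Lam * 2 powr m * c * 2 ^ DIM('a) * ((p + 2) * T) / s"
      using assms(1-7) c T by (intro mult_imp_le_div_pos mult_left_le) auto
    finally show "Lam * 2 powr m * c * 2 ^ DIM('a) * R ^ (DIM('a) - 1)
        \<le> Lam * 2 powr m * c * 2 ^ DIM('a) * (p + 2) / s * T" by simp
  qed
  finally show ?thesis .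
qed

text \<open>Clipping is 1-Lipschitz and \<open>min\<close> does not exceed the larger of the two
  differences; the p-th power of a maximum is at most the sum of the p-th powers. Hence coefficient
  1 on both terms.\<close>

lemma abs_diff_truncation_powr_le:
  fixes a b f g p :: real
  assumes "p \<ge> 0"
  shows "\<bar>min (max a (-1)) f - min (max b (-1)) g\<bar> powr p \<le> \<bar>a - b\<bar> powr p + \<bar>f - g\<bar> powr p"
proof -
  have "\<bar>max a (-1) - max b (-1)\<bar> \<le> \<bar>a - b\<bar>"
    by linarith
  moreover have "\<bar>min a' f - min b' g\<bar> \<le> max \<bar>a' - b'\<bar> \<bar>f - g\<bar>" for a' b'
    by linarith
  ultimately have "\<bar>min (max a (-1)) f - min (max b (-1)) g\<bar> \<le> max \<bar>a - b\<bar> \<bar>f - g\<bar>"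
    by (meson max.mono order.refl order.trans)
  then have "\<bar>min (max a (-1)) f - min (max b (-1)) g\<bar> powr p \<le> max \<bar>a - b\<bar> \<bar>f - g\<bar> powr p"
    using assms by (intro powr_mono2) auto
  also have "\<dots> \<le> \<bar>a - b\<bar> powr p + \<bar>f - g\<bar> powr p"
    by (simp add: max_def)
  finally show ?thesis .
qed

subsection \<open>Comparison with the truncated minimizer\<close>

lemma minimizer_inner_energy_le:
  fixes u :: "'a::euclidean_space \<Rightarrow> real" and p s R :: real
  assumes par: "p > 1" "0 < s" "s < 1" "R \<ge> 2"
    and W: "W1 W lam Lam theta m" "Lam \<ge> 1" "m \<ge> 0"
    and nonneg: "\<And>x. x \<in> {-1..1} \<Longrightarrow> W x \<ge> 0" and lsc: "lsc_on_interval W"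
    and u: "minimizer W p s u (ball 0 (R + 2))"
  shows "ennreal (1 - s) * ((1/2) * gagliardo p s u (ball 0 (R + 1)) (ball 0 (R + 1)))
      + (\<integral>\<^sup>+x. ennreal (indicator (ball 0 (R + 1)) x * W (u x)) \<partial>lebesgue)
    \<le> Eps W p s (cutoff R) (ball (0::'a) (R + 2))"
proof -
  let ?\<Omega> = "ball (0::'a) (R + 2)" and ?C = "ball (0::'a) (R + 1)"
  let ?G = "gagliardo p s u ?C ?C"
  \<comment> \<open>Since \<open>u \<ge> -1\<close> holds only almost everywhere, \<open>u\<close> is clipped so that \<open>v = -1\<close> at every point of \<open>?C\<close>.\<close>
  define v where "v x = min (max (u x) (-1)) (cutoff R x)" for x
  have \<psi>: "(cutoff R :: 'a \<Rightarrow> real) \<in> borel_measurable lebesgue"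
    by (intro measurable_completion) (simp add: borel_measurable_cutoff)
  have um: "u \<in> borel_measurable lebesgue" and Ku: "Kps p s u ?\<Omega> < \<infinity>"
    and ub: "AE x in lebesgue. \<bar>u x\<bar> \<le> 1"
    using u by (auto simp: minimizer_def Xsp_def)
  have vm: "v \<in> borel_measurable lebesgue"
    unfolding v_def[abs_def] using um \<psi> by measurable
  have vb: "\<bar>v x\<bar> \<le> 1" for x
    using cutoff_bounds[of R x] unfolding v_def min_def max_def by auto
  have v_in: "v x = -1" if "x \<in> ?C" for x
    using cutoff_inside[OF that] by (simp add: v_def)
  have v_le: "\<bar>v x - v y\<bar> powr p \<le> \<bar>u x - u y\<bar> powr p + \<bar>cutoff R x - cutoff R y\<bar> powr p" for x y
    unfolding v_def using par by (intro abs_diff_truncation_powr_le) auto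
  have CO: "?C \<subseteq> ?\<Omega>" by auto
  have inner: "gagliardo p s v ?\<Omega> ?\<Omega> + ?G \<le> gagliardo p s u ?\<Omega> ?\<Omega> + gagliardo p s (cutoff R) ?\<Omega> ?\<Omega>"
  proof (rule gagliardo_add_le[OF um vm \<psi>])
    fix x y
    show "\<bar>v x - v y\<bar> powr p + indicator ?C x * indicator ?C y * \<bar>u x - u y\<bar> powr p
       \<le> \<bar>u x - u y\<bar> powr p + \<bar>cutoff R x - cutoff R y\<bar> powr p"
    proof (cases "x \<in> ?C \<and> y \<in> ?C")
      case True
      then show ?thesis by (simp add: v_in)
    next
      case False
      then have "indicator ?C x * indicator ?C y = (0::real)" by (auto simp: indicator_def)
      then show ?thesis using v_le[of x y] by (simp only: mult_zero_left add_0_right)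
    qed
  qed (use CO in auto)
  \<comment> \<open>No pair in this product has both points in \<open>?C\<close>, so nothing is
    gained here and the comparison is used with the empty set.\<close>
  have outer: "gagliardo p s v ?\<Omega> (- ?\<Omega>) + gagliardo p s u {} {}
      \<le> gagliardo p s u ?\<Omega> (- ?\<Omega>) + gagliardo p s (cutoff R) ?\<Omega> (- ?\<Omega>)"
    using v_le by (intro gagliardo_add_le[OF um vm \<psi>]) auto
  have "(1/2) * (gagliardo p s v ?\<Omega> ?\<Omega> + ?G) + gagliardo p s v ?\<Omega> (- ?\<Omega>)
    \<le> (1/2) * (gagliardo p s u ?\<Omega> ?\<Omega> + gagliardo p s (cutoff R) ?\<Omega> ?\<Omega>)
      + (gagliardo p s u ?\<Omega> (- ?\<Omega>) + gagliardo p s (cutoff R) ?\<Omega> (- ?\<Omega>))"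
    using outer by (intro add_mono mult_left_mono inner) (auto simp: gagliardo_empty)
  then have K: "Kps p s v ?\<Omega> + (1/2) * ?G \<le> Kps p s u ?\<Omega> + Kps p s (cutoff R) ?\<Omega>"
    unfolding Kps_gagliardo by (simp add: distrib_left add_ac)
  have "Kps p s v ?\<Omega> \<le> Kps p s u ?\<Omega> + Kps p s (cutoff R) ?\<Omega>"
    using K by (rule order.trans[rotated]) simp
  also have "\<dots> < \<infinity>"
    using Ku Kps_cutoff_le(1)[OF par] by simp
  finally have "v \<in> Xsp s p ?\<Omega>"
    using vm vb by (simp add: Xsp_def)
  \<comment> \<open>Outside \<open>?\<Omega>\<close> the cutoff is 1, and clipping at -1 and 1
    leaves u unchanged almost everywhere.\<close>
  moreover have "AE x in lebesgue. x \<notin> ?\<Omega> \<longrightarrow> v x = u x"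
    using ub by eventually_elim (auto simp: v_def cutoff_outside)
  ultimately have Euv: "Eps W p s u ?\<Omega> \<le> Eps W p s v ?\<Omega>"
    using u by (auto simp: minimizer_def)
  let ?P = "\<lambda>A w. \<integral>\<^sup>+x. ennreal (indicator A x * W (w x)) \<partial>lebesgue"
  have P: "?P ?\<Omega> v + ?P ?C u \<le> ?P ?\<Omega> u + ?P ?\<Omega> (cutoff R)"
  proof (rule potential_add_le[OF lsc nonneg um vm \<psi> ub])
    show "AE x in lebesgue. x \<in> ?\<Omega> \<longrightarrow> W (v x) + indicator ?C x * W (u x) \<le> W (u x) + W (cutoff R x)"
      using ub
    proof eventually_elim
      case (elim x)
      \<comment> \<open>Off \<open>?C\<close>, W(v x) is therefore one of the two terms on the right
        and the other is nonnegative. On \<open>?C\<close>, W(v x) \<le> 0 makes room for W(u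
        x).\<close>
      have "v x = u x \<or> v x = cutoff R x"
        using elim by (auto simp: v_def min_def)
      moreover have "W (u x) \<ge> 0" "W (cutoff R x) \<ge> 0"
        using elim cutoff_bounds[of R x] by (auto intro!: nonneg simp: abs_le_iff)
      moreover have "W (v x) \<le> 0" if "x \<in> ?C"
        using v_in[OF that] W1_bounds(1)[OF W] by simp
      ultimately show ?case by (cases "x \<in> ?C") auto
    qed
  qed (use CO vb in \<open>auto simp: cutoff_bounds\<close>)
  let ?B = "ennreal (1 - s) * ((1/2) * ?G) + ?P ?C u"
  have "Eps W p s v ?\<Omega> + ?B = ennreal (1 - s) * (Kps p s v ?\<Omega> + (1/2) * ?G) + (?P ?\<Omega> v + ?P ?C u)"
    by (simp add: Eps_def distrib_left add_ac)
  also have "\<dots> \<le> ennreal (1 - s) * (Kps p s u ?\<Omega> + Kps p s (cutoff R) ?\<Omega>) + (?P ?\<Omega> u + ?P ?\<Omega> (cutoff R))"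
    by (intro add_mono mult_left_mono K P) auto
  also have "\<dots> = Eps W p s u ?\<Omega> + Eps W p s (cutoff R) ?\<Omega>"
    by (simp add: Eps_def distrib_left add_ac)
  finally have "Eps W p s u ?\<Omega> + ?B \<le> Eps W p s u ?\<Omega> + Eps W p s (cutoff R) ?\<Omega>"
    using Euv by (meson add_right_mono order.trans)
  \<comment> \<open>Finiteness is what permits cancelling this term: the kinetic part is finite by
    admissibility, the potential part because W is bounded and the ball has finite volume.\<close>
  moreover have "Eps W p s u ?\<Omega> \<noteq> \<infinity>"
  proof -
    have "?P ?\<Omega> u \<le> (\<integral>\<^sup>+x. ennreal (Lam * 2 powr m) * indicator ?\<Omega> x \<partial>lebesgue)"
    proof (rule nn_integral_mono_AE, use ub in eventually_elim)
      case (elim x)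
      then have "W (u x) \<le> Lam * 2 powr m"
        by (intro W1_bounds(2)[OF W]) (auto simp: abs_le_iff)
      then show ?case by (auto simp: indicator_def intro: ennreal_leI)
    qed
    also have "\<dots> = ennreal (Lam * 2 powr m) * emeasure lborel ?\<Omega>"
      unfolding nn_integral_completion by (rule nn_integral_cmult_indicator) simp
    also have "\<dots> < \<infinity>"
      using emeasure_lborel_ball_finite[of "0::'a" "R + 2"] by (simp add: ennreal_mult_less_top)
    finally show ?thesis
      using Ku by (simp add: Eps_def ennreal_mult_eq_top_iff less_top)
  qed
  ultimately show ?thesis
    by (simp add: ennreal_add_left_cancel_le)
qed

section \<open>Assembling the estimate and its constant\<close>

theorem mainTheorem6:
  fixes p m Lam :: real
  assumes "p > 1" and "m \<ge> p" and "Lam \<ge> 1"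
  shows "\<exists>C>0. \<forall>(W::real \<Rightarrow> real) lam theta q c1 s R (u :: 'a::euclidean_space \<Rightarrow> real).
     (\<forall>x\<in>{-1..1}. W x \<ge> 0) \<and> lsc_on_interval W \<and>
     0 < lam \<and> lam \<le> 1 \<and> -1 < theta \<and> theta < 1 \<and> W1 W lam Lam theta m \<and>
     0 < q \<and> q < 1 \<and> 0 < c1 \<and> W2 W q c1 m \<and>
     0 < s \<and> s < 1 \<and> R \<ge> 2 \<and> minimizer W p s u (ball 0 (R + 2))
     \<longrightarrow> Eps W p s u (ball 0 R) \<le> ennreal (C / s *
           (if s < 1 / p then R powr (real DIM('a) - s * p) / (1 - s * p)
            else if s = 1 / p then R powr (real DIM('a) - 1) * ln R
            else R powr (real DIM('a) - 1) / (s * p - 1)))"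
proof -
  define c where "c = sphere_area TYPE('a)"
  \<comment> \<open>The three constants belong to the far interactions of u (a), the kinetic energy
    of the cutoff (b) and its potential energy (d).\<close>
  define a where "a = 2 powr p * 2 * c ^ 2"
  define b where "b = 2 * (2 powr p * 2 * c ^ 2 + 2 powr p * c ^ 2 * 2 ^ DIM('a) * (p + 2))"
  define d where "d = Lam * 2 powr m * c * 2 ^ DIM('a) * (p + 2)"
  have c: "c > 0" unfolding c_def by (rule sphere_area_pos)
  have pos: "a > 0" "b > 0" "d > 0"
    unfolding a_def b_def d_def using assms c by (auto intro!: mult_pos_pos add_pos_pos)
  have bound: "Eps W p s u (ball 0 R) \<le> ennreal ((3 * (b + d) + a) / s * growth_rate DIM('a) (s * p) R)"
    if nonneg: "\<forall>x\<in>{-1..1}. W x \<ge> 0" and lsc: "lsc_on_interval W" and W: "W1 W lam Lam theta m"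
      and s: "0 < s" "s < 1" and R: "R \<ge> 2" and u: "minimizer W p s u (ball 0 (R + 2))"
    for W lam theta s R and u :: "'a \<Rightarrow> real"
  proof -
    define T where "T = growth_rate DIM('a) (s * p) R"
    have T: "T \<ge> 0" unfolding T_def using R by (rule growth_rate_nonneg)
    have W': "m \<ge> 0" using assms by simp
    have um: "u \<in> borel_measurable lebesgue" and ub: "AE x in lebesgue. \<bar>u x\<bar> \<le> 1"
      using u by (auto simp: minimizer_def Xsp_def)
    let ?P = "\<lambda>A. \<integral>\<^sup>+x. ennreal (indicator A x * W (u x)) \<partial>lebesgue"
    let ?B = "ball (0::'a) R" and ?C = "ball (0::'a) (R + 1)"
    define H where "H = (1/2) * gagliardo p s u ?C ?C"
    define X where "X = gagliardo p s u ?B (- ?C)"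
    have "Eps W p s (cutoff R) (ball (0::'a) (R + 2)) \<le> ennreal (b / s * T) + ennreal (d / s * T)"
      unfolding Eps_def b_def d_def c_def T_def
      by (intro add_mono Kps_cutoff_le(2) potential_cutoff_le[OF assms(1) s R W assms(3) W'] assms(1) s R)
    also have "\<dots> = ennreal ((b + d) / s * T)"
      using pos s T by (subst ennreal_plus[symmetric]) (auto simp: add_divide_distrib distrib_right)
    finally have inner: "ennreal (1 - s) * H + ?P ?C \<le> ennreal ((b + d) / s * T)"
      unfolding H_def
      using minimizer_inner_energy_le[OF assms(1) s R W assms(3) W' _ lsc u] nonneg
      by (meson order.trans)
    have "X \<le> ennreal (2 powr p * (2 * c ^ 2 / (s * p) * T))"
      unfolding X_def c_def T_def by (intro gagliardo_ball_complement_le ub assms s R)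
    also have "\<dots> \<le> ennreal (a / s * T)"
    proof (rule ennreal_leI)
      have "2 powr p * (2 * c ^ 2 / (s * p) * T) = a / s * T / p"
        by (simp add: a_def)
      also have "\<dots> \<le> a / s * T"
        using assms pos s T by (intro divide_le_numerator) auto
      finally show "2 powr p * (2 * c ^ 2 / (s * p) * T) \<le> a / s * T" .
    qed
    finally have X: "X \<le> ennreal (a / s * T)" .
    have two: "2 * H = gagliardo p s u ?C ?C"
      unfolding H_def by (simp add: ennreal_times_divide flip: mult.assoc)
    \<comment> \<open>A point y outside \<open>?B\<close> is either outside \<open>?C\<close>, which
      is the far part, or in \<open>?C\<close> together with x. The latter costs the full square of
      \<open>?C\<close>, that is 2H, so H occurs three times in all.\<close>
    have "gagliardo p s u ?B (- ?B) \<le> X + gagliardo p s u ?C ?C"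
      unfolding X_def by (rule gagliardo_split_le[OF um]) auto
    then have "Kps p s u ?B \<le> H + (X + 2 * H)"
      unfolding Kps_gagliardo two unfolding H_def
      by (intro add_mono mult_left_mono gagliardo_mono) auto
    moreover have "?P ?B \<le> ?P ?C"
    proof (rule nn_integral_mono_AE, use ub in eventually_elim)
      case (elim x)
      then have "W (u x) \<ge> 0" using nonneg by (auto simp: abs_le_iff)
      then show ?case by (intro ennreal_leI mult_right_mono) (auto simp: indicator_def)
    qed
    ultimately have "Eps W p s u ?B \<le> ennreal (1 - s) * (H + (X + 2 * H)) + ?P ?C"
      unfolding Eps_def by (intro add_mono mult_left_mono) auto
    \<comment> \<open>Tripling the potential as well makes the sum a multiple of the quantity
      bounded in \<open>inner\<close>.\<close>
    also have "\<dots> \<le> ennreal (1 - s) * (H + (X + 2 * H)) + 3 * ?P ?C"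
      using mult_right_mono[of 1 3 "?P ?C"] by (intro add_left_mono) simp
    also have "\<dots> = 3 * (ennreal (1 - s) * H + ?P ?C) + ennreal (1 - s) * X"
    proof -
      have "H + (X + 2 * H) = 3 * H + X"
        using distrib_right[of 1 2 H] by (simp add: add_ac)
      then show ?thesis by (simp only: distrib_left mult_ac add_ac)
    qed
    also have "\<dots> \<le> 3 * ennreal ((b + d) / s * T) + 1 * ennreal (a / s * T)"
      using s by (intro add_mono mult_left_mono mult_mono inner X) auto
    also have "\<dots> = ennreal ((3 * (b + d) + a) / s * T)"
    proof -
      have "3 * ennreal ((b + d) / s * T) = ennreal (3 * ((b + d) / s * T))"
        using pos s T by (subst ennreal_mult) auto
      then have "3 * ennreal ((b + d) / s * T) + 1 * ennreal (a / s * T)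
          = ennreal (3 * ((b + d) / s * T) + a / s * T)"
        using pos s T by (subst ennreal_plus) auto
      also have "3 * ((b + d) / s * T) + a / s * T = (3 * (b + d) + a) / s * T"
        by (simp add: add_divide_distrib distrib_right)
      finally show ?thesis .
    qed
    finally show ?thesis unfolding T_def .
  qed
  have rate: "growth_rate DIM('a) (s * p) R =
      (if s < 1 / p then R powr (real DIM('a) - s * p) / (1 - s * p)
            else if s = 1 / p then R powr (real DIM('a) - 1) * ln R
            else R powr (real DIM('a) - 1) / (s * p - 1))" for s R
    unfolding growth_rate_def using assms by (auto simp: field_simps)
  show ?thesis
    unfolding rate[symmetric]
  proof (intro exI[of _ "3 * (b + d) + a"] conjI allI impI)
    show "3 * (b + d) + a > 0" using pos by simp
  qed (use bound in blast)
qed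

end
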